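(* Let $1<p<\infty$, $k\in\mathbb{N}$ with $k\ge 1$, $0<\lambda<1$, and $\gamma\in\mathbb{R}$. Let $I_{k,\lambda+i\gamma}$ be the discrete fractional integral operator $$I_{k,\lambda+i\gamma}f(n')=\sum_{m=1}^{\infty}\frac{f(n'-m^k)}{m^{\lambda+i\gamma}},\qquad n'\in\mathbb{Z}.$$ Then: (1) $I_{k,\lambda+i\gamma}$ is of weak type $(1,p)$ if and only if $\lambda\ge \frac1p$; (2) $I_{k,\lambda+i\gamma}$ is bounded from $\ell^1(\mathbb{Z})$ into $\ell^p(\mathbb{Z})$ if and only if $\lambda>\frac1p$.
   Context: The operator is initially defined on the discrete Schwartz space $\mathscr{S}(\mathbb{Z})$ (rapidly decreasing functions $f:\mathbb{Z}\to\mathbb{C}$), and boundedness means that it extends to a bounded operator between the indicated spaces. $\ell^p(\mathbb{Z})$ has norm $\|f\|_{\ell^p}=(\sum_{n'\in\mathbb{Z}}|f(n')|^p)^{1/p}$. With $\mu$ the counting measure on $\mathbb{Z}$, $\ell^{p,\infty}(\mathbb{Z})$ is the space of functions with $\|f\|_{\ell^{p,\infty}}:=\sup_{\alpha>0}\alpha\,\mu\{n'\in\mathbb{Z}:|f(n')|>\alpha\}^{1/p}<\infty$. An operator $t$ is of weak type $(1,p)$ if it extends to a bounded operator from $\ell^1$ into $\ell^{p,\infty}$, i.e. there is $C>0$ with $\|tf\|_{\ell^{p,\infty}}\le C\|f\|_{\ell^1}$ for all $f\in\ell^1$. *)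

theory Defs
  imports "HOL-Analysis.Analysis"
begin

definition schwartz :: "(int \<Rightarrow> complex) set" where
  "schwartz = {f. \<forall>N::nat. \<exists>C::real. \<forall>n. \<bar>real_of_int n\<bar> ^ N * norm (f n) \<le> C}"

(* The norms below are real-valued and carry their usual meaning only on the
   corresponding space, so finiteness of a norm is expressed by membership. *)

definition lp :: "real \<Rightarrow> (int \<Rightarrow> complex) set" where
  "lp p = {f. (\<lambda>n. norm (f n) powr p) summable_on UNIV}"

definition lp_norm :: "real \<Rightarrow> (int \<Rightarrow> complex) \<Rightarrow> real" where
  "lp_norm p f = (\<Sum>\<^sub>\<infinity>n. norm (f n) powr p) powr (1 / p)"

(* The cardinality of an infinite set is 0, so membership also demands that
   all superlevel sets have finite counting measure. *)

definition weak_lp :: "real \<Rightarrow> (int \<Rightarrow> complex) set" where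
  "weak_lp p = {f. (\<forall>\<alpha>>0. finite {n. norm (f n) > \<alpha>}) \<and>
     bdd_above ((\<lambda>\<alpha>. \<alpha> * real (card {n. norm (f n) > \<alpha>}) powr (1 / p)) ` {0<..})}"

definition weak_lp_norm :: "real \<Rightarrow> (int \<Rightarrow> complex) \<Rightarrow> real" where
  "weak_lp_norm p f = (SUP \<alpha>\<in>{0<..}. \<alpha> * real (card {n. norm (f n) > \<alpha>}) powr (1 / p))"

definition linear_on_space ::
    "(int \<Rightarrow> complex) set \<Rightarrow> ((int \<Rightarrow> complex) \<Rightarrow> int \<Rightarrow> complex) \<Rightarrow> bool" where
  "linear_on_space X T \<longleftrightarrow>
     (\<forall>f\<in>X. \<forall>g\<in>X. T (\<lambda>n. f n + g n) = (\<lambda>n. T f n + T g n)) \<and>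
     (\<forall>c. \<forall>f\<in>X. T (\<lambda>n. c * f n) = (\<lambda>n. c * T f n))"

(* Only the values of t on the Schwartz space matter; T is its extension to X. *)

definition extends_to_bounded ::
    "(int \<Rightarrow> complex) set \<Rightarrow> ((int \<Rightarrow> complex) \<Rightarrow> real) \<Rightarrow>
     (int \<Rightarrow> complex) set \<Rightarrow> ((int \<Rightarrow> complex) \<Rightarrow> real) \<Rightarrow>
     ((int \<Rightarrow> complex) \<Rightarrow> int \<Rightarrow> complex) \<Rightarrow> bool" where
  "extends_to_bounded X normX Y normY t \<longleftrightarrow>
     (\<exists>T. linear_on_space X T \<and> (\<forall>f\<in>schwartz. T f = t f) \<and>
       (\<exists>C>0. \<forall>f\<in>X. T f \<in> Y \<and> normY (T f) \<le> C * normX f))"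

definition weak_type_1 :: "real \<Rightarrow> ((int \<Rightarrow> complex) \<Rightarrow> int \<Rightarrow> complex) \<Rightarrow> bool" where
  "weak_type_1 p t \<longleftrightarrow> extends_to_bounded (lp 1) (lp_norm 1) (weak_lp p) (weak_lp_norm p) t"

definition bounded_lp_lq :: "real \<Rightarrow> real \<Rightarrow> ((int \<Rightarrow> complex) \<Rightarrow> int \<Rightarrow> complex) \<Rightarrow> bool" where
  "bounded_lp_lq p q t \<longleftrightarrow> extends_to_bounded (lp p) (lp_norm p) (lp q) (lp_norm q) t"

(* The summation index is shifted: Suc j plays the role of m = 1, 2, ... *)

definition frac_int :: "nat \<Rightarrow> complex \<Rightarrow> (int \<Rightarrow> complex) \<Rightarrow> int \<Rightarrow> complex" where
  "frac_int k s f n = (\<Sum>j. f (n - int (Suc j) ^ k) / of_nat (Suc j) powr s)"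

end

theory Submission
  imports Defs
begin

text \<open>
  The operator is convolution with the kernel \<open>K\<close> that takes the value \<open>m powr - s\<close> at \<open>m ^ k\<close> and
  vanishes elsewhere. Since \<open>m \<mapsto> m ^ k\<close> is injective, \<open>K\<close> has the absolute values
  \<open>m powr - lam\<close>, one at each of these points. The claim amounts to this: convolution with \<open>K\<close> maps
  \<open>\<ell>\<^sup>1\<close> into \<open>\<ell>\<^sup>p\<close>, or into weak \<open>\<ell>\<^sup>p\<close>, exactly when \<open>K\<close> itself lies in that space.

  Necessity comes from the unit mass at the origin, which the operator sends to \<open>K\<close>. It lies in
  the Schwartz space, so every extension of the operator has to agree with the formula there
  (lemma \<open>extends_to_bounded_unit_mass\<close>). If \<open>K\<close> is in \<open>\<ell>\<^sup>p\<close>, the series of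
  \<open>m powr - (lam * p)\<close> converges, so \<open>lam > 1 / p\<close>. If \<open>K\<close> is in weak \<open>\<ell>\<^sup>p\<close>, the
  \<open>N\<close> points where \<open>K\<close> has size at least \<open>N powr - lam\<close> show that
  \<open>N powr (1 / p - lam)\<close> stays bounded, so \<open>lam \<ge> 1 / p\<close>.

  Sufficiency in the strong case is Young's inequality for an \<open>\<ell>\<^sup>1\<close> function and an
  \<open>\<ell>\<^sup>p\<close> kernel, which follows from Jensen's inequality by exchanging two sums
  (lemma \<open>shift_sum_strong_bound\<close>). In the weak case (lemma \<open>shift_sum_superlevel_bound\<close>)
  the coefficients are first bounded by \<open>m powr - (1 / p)\<close>, and the kernel is cut
  at an index depending on the level \<open>\<alpha>\<close>: the flat tail contributes at most
  \<open>\<alpha> / 2\<close> at every point, so where the result exceeds \<open>\<alpha>\<close> the finite head, whose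
  \<open>\<ell>\<^sup>1\<close> norm is known, exceeds \<open>\<alpha> / 2\<close>, and Chebyshev's inequality counts such points.
  The head has a good norm because \<open>1 / p < 1\<close>, so that the sum of \<open>m powr - (1 / p)\<close> over
  \<open>m \<le> M\<close> is only of the order \<open>M powr (1 - 1 / p)\<close>. In both cases the explicit series
  already converges on all of \<open>\<ell>\<^sup>1\<close> and serves as the extension.
\<close>

section \<open>Elementary inequalities\<close>

text \<open>
  Young's inequality for the product \<open>b * x powr (p - 1)\<close> is the tangent-line inequality
  for the convex function \<open>\<lambda>b. b powr p\<close>, and it includes the boundary point \<open>0\<close>.
\<close>

lemma powr_above_tangent:
  fixes b x p :: real
  assumes "1 < p" "0 \<le> b" "0 \<le> x"
  shows "x powr p + p * x powr (p - 1) * (b - x) \<le> b powr p"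
proof -
  have "b * x powr (p - 1) \<le> b powr p / p + (x powr (p - 1)) powr (p / (p - 1)) / (p / (p - 1))"
    by (rule Youngs_inequality) (use assms in \<open>auto simp: field_simps\<close>)
  also have "(x powr (p - 1)) powr (p / (p - 1)) = x powr p"
    using assms by (simp add: powr_powr)
  finally have "p * (b * x powr (p - 1)) \<le> p * (b powr p / p + x powr p / (p / (p - 1)))"
    using assms by (intro mult_left_mono) auto
  also have "\<dots> = b powr p + (p - 1) * x powr p"
    using assms by (simp add: field_simps)
  finally have "p * (b * x powr (p - 1)) \<le> b powr p + (p - 1) * x powr p" .
  moreover have "x powr (p - 1) * x = x powr p"
    using assms by (cases "x = 0") (simp_all add: powr_diff)
  ultimately show ?thesis
    by (simp add: algebra_simps)
qed

text \<open>
  The weights have total mass at most \<open>F\<close>, not exactly \<open>F\<close>. This suffices because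
  \<open>b powr p\<close> vanishes at \<open>0\<close>: the missing mass can be thought of as sitting there. The proof
  sums the tangent inequality at the mean value \<open>x = S / F\<close> against the weights.
\<close>

lemma suminf_powr_Jensen:
  fixes w b :: "nat \<Rightarrow> real"
  assumes p: "1 < p" and w: "\<And>j. 0 \<le> w j" "summable w" and F: "suminf w \<le> F"
    and b: "\<And>j. 0 \<le> b j" "\<And>j. b j \<le> 1"
  shows "(\<Sum>j. w j * b j) powr p \<le> F powr (p - 1) * (\<Sum>j. w j * b j powr p)"
proof -
  have wb: "summable (\<lambda>j. w j * b j)"
    by (rule summable_comparison_test'[OF w(2), of 0])
      (use w b in \<open>auto simp: abs_mult mult_left_le\<close>)
  have wbp: "summable (\<lambda>j. w j * b j powr p)"
    by (rule summable_comparison_test'[OF w(2), of 0])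
      (use w b p in \<open>auto simp: abs_mult intro!: mult_left_le powr_le1\<close>)
  define S where "S = (\<Sum>j. w j * b j)"
  have S0: "0 \<le> S"
    unfolding S_def using w b by (intro suminf_nonneg wb) auto
  have "S \<le> suminf w"
    unfolding S_def using w b by (intro suminf_le wb) (auto simp: mult_left_le)
  with F have SF: "S \<le> F" by simp
  show ?thesis
  proof (cases "F = 0")
    case True
    with S0 SF show ?thesis by (simp add: S_def)
  next
    case False
    with S0 SF have Fpos: "0 < F" by simp
    define x where "x = S / F"
    have x0: "0 \<le> x" using S0 Fpos by (simp add: x_def)
    have xx: "x powr (p - 1) * x = x powr p"
      using x0 by (cases "x = 0") (simp_all add: powr_diff)
    have sm: "(\<lambda>j. (x powr p - p * x powr (p - 1) * x) * w j + p * x powr (p - 1) * (w j * b j))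
        sums ((x powr p - p * x powr (p - 1) * x) * suminf w + p * x powr (p - 1) * S)"
      unfolding S_def by (intro sums_add sums_mult summable_sums wb w)
    have "(x powr p - p * x powr (p - 1) * x) * suminf w + p * x powr (p - 1) * S
        \<le> (\<Sum>j. w j * b j powr p)"
    proof (rule sums_le[OF _ sm summable_sums[OF wbp]])
      fix j
      have "w j * (x powr p + p * x powr (p - 1) * (b j - x)) \<le> w j * b j powr p"
        by (intro mult_left_mono powr_above_tangent) (use p w b x0 in auto)
      then show "(x powr p - p * x powr (p - 1) * x) * w j + p * x powr (p - 1) * (w j * b j)
          \<le> w j * b j powr p"
        by (simp add: algebra_simps)
    qed
    also have "(x powr p - p * x powr (p - 1) * x) * suminf w + p * x powr (p - 1) * S
        = x powr p * (p * F - (p - 1) * suminf w)"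
    proof -
      have S: "S = x * F" using Fpos by (simp add: x_def)
      show ?thesis unfolding S xx[symmetric] by (simp add: algebra_simps)
    qed
    finally have "x powr p * (p * F - (p - 1) * suminf w) \<le> (\<Sum>j. w j * b j powr p)" .
    moreover have "x powr p * F \<le> x powr p * (p * F - (p - 1) * suminf w)"
    proof (rule mult_left_mono)
      have "(p - 1) * suminf w \<le> (p - 1) * F" using p F by (intro mult_left_mono) auto
      then show "F \<le> p * F - (p - 1) * suminf w" by (simp add: algebra_simps)
    qed simp
    ultimately have "x powr p * F \<le> (\<Sum>j. w j * b j powr p)" by linarith
    then have "F powr (p - 1) * (x powr p * F) \<le> F powr (p - 1) * (\<Sum>j. w j * b j powr p)"
      by (intro mult_left_mono) auto
    moreover have "F powr (p - 1) * (x powr p * F) = S powr p"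
      using Fpos S0 by (simp add: x_def powr_divide powr_diff)
    ultimately show ?thesis by (simp add: S_def)
  qed
qed

text \<open>
  Comparison with the integral of \<open>t powr - a\<close> over \<open>[0, M]\<close>. The induction step is the
  Bernoulli inequality \<open>t powr (1 - a) \<le> 1 - (1 - a) * (1 - t)\<close> at \<open>t = M / (M + 1)\<close>, an
  instance of weighted arithmetic and geometric means.
\<close>

lemma sum_powr_minus_le:
  fixes a :: real
  assumes "0 < a" "a < 1"
  shows "(\<Sum>j<M. real (Suc j) powr - a) \<le> real M powr (1 - a) / (1 - a)"
proof (induction M)
  case 0
  show ?case by simp
next
  case (Suc M)
  define y where "y = real (Suc M)"
  have y: "0 < y" "real M = y - 1" by (auto simp: y_def)
  have *: "(1 - a) * y powr - a + (y - 1) powr (1 - a) \<le> y powr (1 - a)"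
  proof (cases "M = 0")
    case True
    then show ?thesis using assms by (simp add: y_def)
  next
    case False
    then have y1: "1 < y" by (simp add: y_def)
    have "((y - 1) / y) powr (1 - a) * 1 powr a \<le> (1 - a) * ((y - 1) / y) + a * 1"
      by (rule Youngs_inequality_0) (use assms y1 in auto)
    also have "\<dots> = 1 - (1 - a) / y"
      using y1 by (simp add: field_simps)
    finally have "y powr (1 - a) * ((y - 1) / y) powr (1 - a) \<le> y powr (1 - a) * (1 - (1 - a) / y)"
      by (intro mult_left_mono) auto
    moreover have "y powr (1 - a) * ((y - 1) / y) powr (1 - a) = (y - 1) powr (1 - a)"
      using y1 by (simp add: powr_divide)
    moreover have "y powr (1 - a) / y = y powr - a"
      using y1 by (simp add: powr_diff powr_minus divide_inverse)
    moreover have "y powr (1 - a) * (1 - (1 - a) / y)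
        = y powr (1 - a) - (1 - a) * (y powr (1 - a) / y)"
      by (simp add: right_diff_distrib mult.commute)
    ultimately show ?thesis by simp
  qed
  have "(\<Sum>j<Suc M. real (Suc j) powr - a) \<le> real M powr (1 - a) / (1 - a) + y powr - a"
    using Suc.IH by (simp add: y_def)
  also have "\<dots> = ((1 - a) * y powr - a + (y - 1) powr (1 - a)) / (1 - a)"
    using assms by (simp add: y(2) field_simps)
  also have "\<dots> \<le> y powr (1 - a) / (1 - a)"
    using * assms by (intro divide_right_mono) auto
  finally show ?case by (simp add: y_def)
qed

section \<open>Summing translates of a summable function\<close>

lemma lp_1_iff: "f \<in> lp 1 \<longleftrightarrow> (\<lambda>n. norm (f n)) summable_on UNIV"
  by (simp add: lp_def)

lemma lp_norm_1: "lp_norm 1 f = (\<Sum>\<^sub>\<infinity>n. norm (f n))"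
  by (simp add: lp_norm_def infsum_nonneg)

text \<open>
  Used in two ways: for a fixed point \<open>n\<close> with \<open>x\<close> ranging over the shifts, and for a fixed
  shift with \<open>x\<close> ranging over points of \<open>\<int>\<close>.
\<close>

lemma sum_comp_inj_le_lp_norm_1:
  assumes f: "f \<in> lp 1" and F: "finite F" "inj_on h F"
  shows "(\<Sum>x\<in>F. norm (f (h x))) \<le> lp_norm 1 f"
proof -
  have "(\<Sum>x\<in>F. norm (f (h x))) = (\<Sum>n\<in>h ` F. norm (f n))"
    using F by (simp add: sum.reindex)
  also have "\<dots> \<le> (\<Sum>\<^sub>\<infinity>n. norm (f n))"
    by (rule finite_sum_le_infsum) (use f F in \<open>auto simp: lp_1_iff\<close>)
  finally show ?thesis by (simp add: lp_norm_1)
qed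

lemma lp_norm_nonneg: "0 \<le> lp_norm p f"
  by (simp add: lp_norm_def)

text \<open>
  Convolution with the kernel that has value \<open>c j\<close> at \<open>d j\<close>, provided \<open>d\<close> is injective. Keeping
  the positions \<open>d\<close> apart from the coefficients \<open>c\<close> makes visible that the bounds below
  involve \<open>c\<close> alone.
\<close>

definition shift_sum :: "(nat \<Rightarrow> int) \<Rightarrow> (nat \<Rightarrow> complex) \<Rightarrow> (int \<Rightarrow> complex) \<Rightarrow> int \<Rightarrow> complex" where
  "shift_sum d c f n = (\<Sum>j. c j * f (n - d j))"

context
  fixes d :: "nat \<Rightarrow> int" and c :: "nat \<Rightarrow> complex"
  assumes inj_d: "inj d" and c_le_1: "\<And>j. norm (c j) \<le> 1"
begin

lemma summable_translates:
  assumes f: "f \<in> lp 1"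
  shows "summable (\<lambda>j. norm (f (n - d j)))" "(\<Sum>j. norm (f (n - d j))) \<le> lp_norm 1 f"
proof -
  have *: "(\<Sum>j<m. norm (f (n - d j))) \<le> lp_norm 1 f" for m
    using inj_d by (intro sum_comp_inj_le_lp_norm_1[OF f]) (auto simp: inj_on_def)
  show "summable (\<lambda>j. norm (f (n - d j)))"
    by (rule summableI_nonneg_bounded[OF _ *]) auto
  then show "(\<Sum>j. norm (f (n - d j))) \<le> lp_norm 1 f"
    by (rule suminf_le_const) (rule *)
qed

lemma summable_shift_sum:
  assumes f: "f \<in> lp 1"
  shows "summable (\<lambda>j. norm (f (n - d j)) * norm (c j))"
  by (rule summable_comparison_test'[OF summable_translates(1)[OF f, of n], of 0])
    (use c_le_1 in \<open>auto simp: mult_left_le\<close>)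

lemma summable_shift_sum':
  assumes f: "f \<in> lp 1"
  shows "summable (\<lambda>j. c j * f (n - d j))"
  by (rule summable_norm_cancel)
    (use summable_shift_sum[OF f, of n] in \<open>simp add: norm_mult mult.commute\<close>)

lemma norm_shift_sum_le:
  assumes f: "f \<in> lp 1"
  shows "norm (shift_sum d c f n) \<le> (\<Sum>j. norm (f (n - d j)) * norm (c j))"
  unfolding shift_sum_def
  using summable_norm[of "\<lambda>j. c j * f (n - d j)"] summable_shift_sum[OF f, of n]
  by (simp add: norm_mult mult.commute)

lemma linear_shift_sum: "linear_on_space (lp 1) (shift_sum d c)"
  unfolding linear_on_space_def
proof (intro conjI ballI allI ext)
  fix f g n assume "f \<in> lp 1" "g \<in> lp 1"
  then show "shift_sum d c (\<lambda>n. f n + g n) n = shift_sum d c f n + shift_sum d c g n"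
    by (simp add: shift_sum_def suminf_add summable_shift_sum' ring_distribs)
next
  fix a f n assume "f \<in> lp 1"
  then show "shift_sum d c (\<lambda>n. a * f n) n = a * shift_sum d c f n"
    by (simp add: shift_sum_def suminf_mult summable_shift_sum' mult.left_commute)
qed

lemma shift_sum_extends_to_bounded:
  assumes "\<And>f. f \<in> lp 1 \<Longrightarrow> shift_sum d c f \<in> Y \<and> normY (shift_sum d c f) \<le> C * lp_norm 1 f"
  shows "extends_to_bounded (lp 1) (lp_norm 1) Y normY (shift_sum d c)"
proof -
  have "shift_sum d c f \<in> Y \<and> normY (shift_sum d c f) \<le> (\<bar>C\<bar> + 1) * lp_norm 1 f"
    if "f \<in> lp 1" for f
  proof -
    have "C * lp_norm 1 f \<le> (\<bar>C\<bar> + 1) * lp_norm 1 f"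
      by (intro mult_right_mono lp_norm_nonneg) auto
    with assms[OF that] show ?thesis by linarith
  qed
  moreover have "0 < \<bar>C\<bar> + 1" by simp
  ultimately show ?thesis
    unfolding extends_to_bounded_def using linear_shift_sum by blast
qed

section \<open>The two upper bounds\<close>

text \<open>
  At each point, Jensen's inequality with the translates \<open>norm (f (n - d j))\<close> as weights moves the
  power \<open>p\<close> onto the coefficients. Summing over \<open>n\<close> first then costs one more factor of the
  \<open>\<ell>\<^sup>1\<close> norm.
\<close>

lemma shift_sum_strong_bound:
  assumes p: "1 < p" and cp: "summable (\<lambda>j. norm (c j) powr p)" and f: "f \<in> lp 1"
  shows "shift_sum d c f \<in> lp p"
    and "lp_norm p (shift_sum d c f) \<le> (\<Sum>j. norm (c j) powr p) powr (1 / p) * lp_norm 1 f"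
proof -
  let ?L = "lp_norm 1 f" and ?K = "\<Sum>j. norm (c j) powr p"
  have L: "?L powr (p - 1) * ?L = ?L powr p"
    using lp_norm_nonneg[of 1 f] by (cases "?L = 0") (simp_all add: powr_diff)
  have fin: "(\<Sum>n\<in>F. norm (shift_sum d c f n) powr p) \<le> ?L powr p * ?K" if F: "finite F" for F
  proof -
    have sm: "summable (\<lambda>j. norm (f (n - d j)) * norm (c j) powr p)" for n
      by (rule summable_comparison_test'[OF summable_translates(1)[OF f, of n], of 0])
        (use c_le_1 p in \<open>auto intro!: mult_left_le powr_le1\<close>)
    have "(\<Sum>n\<in>F. norm (shift_sum d c f n) powr p)
        \<le> (\<Sum>n\<in>F. ?L powr (p - 1) * (\<Sum>j. norm (f (n - d j)) * norm (c j) powr p))"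
    proof (rule sum_mono)
      fix n
      have "norm (shift_sum d c f n) powr p \<le> (\<Sum>j. norm (f (n - d j)) * norm (c j)) powr p"
        using p by (intro powr_mono2 norm_shift_sum_le f) auto
      also have "\<dots> \<le> ?L powr (p - 1) * (\<Sum>j. norm (f (n - d j)) * norm (c j) powr p)"
        by (intro suminf_powr_Jensen summable_translates f p) (auto simp: c_le_1)
      finally show "norm (shift_sum d c f n) powr p
        \<le> ?L powr (p - 1) * (\<Sum>j. norm (f (n - d j)) * norm (c j) powr p)" .
    qed
    also have "\<dots> = ?L powr (p - 1) * (\<Sum>j. \<Sum>n\<in>F. norm (f (n - d j)) * norm (c j) powr p)"
      by (simp add: sum_distrib_left[symmetric] suminf_sum sm)
    also have "\<dots> \<le> ?L powr (p - 1) * (\<Sum>j. ?L * norm (c j) powr p)"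
    proof (intro mult_left_mono suminf_le summable_sum sm summable_mult cp)
      fix j
      have "(\<Sum>n\<in>F. norm (f (n - d j))) \<le> ?L"
        by (rule sum_comp_inj_le_lp_norm_1[OF f F]) (auto simp: inj_on_def)
      then show "(\<Sum>n\<in>F. norm (f (n - d j)) * norm (c j) powr p) \<le> ?L * norm (c j) powr p"
        by (simp add: sum_distrib_right[symmetric] mult_right_mono)
    qed auto
    also have "\<dots> = ?L powr p * ?K"
      using cp by (simp add: suminf_mult L[symmetric])
    finally show ?thesis .
  qed
  show mem: "shift_sum d c f \<in> lp p"
    unfolding lp_def mem_Collect_eq
    by (rule nonneg_bdd_above_summable_on) (use fin in \<open>auto intro!: bdd_aboveI2\<close>)
  have "(\<Sum>\<^sub>\<infinity>n. norm (shift_sum d c f n) powr p) \<le> ?L powr p * ?K"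
    by (rule infsum_le_finite_sums) (use mem fin in \<open>auto simp: lp_def\<close>)
  then have "lp_norm p (shift_sum d c f) \<le> (?L powr p * ?K) powr (1 / p)"
    unfolding lp_norm_def using p by (intro powr_mono2 infsum_nonneg) auto
  also have "\<dots> = ?K powr (1 / p) * ?L"
    using p lp_norm_nonneg[of 1 f] cp by (simp add: powr_mult powr_powr suminf_nonneg)
  finally show "lp_norm p (shift_sum d c f) \<le> ?K powr (1 / p) * ?L" .
qed

text \<open>
  The heart of the weak-type estimate. Truncating the kernel at index \<open>M\<close>, of the order
  \<open>(2 * lp_norm 1 f / \<alpha>) powr p\<close>, balances the two halves: beyond \<open>M\<close> the coefficients are so
  small that the tail is at most \<open>\<alpha> / 2\<close> everywhere, while Chebyshev's inequality for the head
  gives a bound of the order of \<open>R * M powr (1 - 1 / p)\<close> with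
  \<open>R = 2 * lp_norm 1 f / \<alpha>\<close>, which is \<open>R powr p\<close>.
\<close>

lemma shift_sum_superlevel_bound:
  assumes p: "1 < p" and cp: "\<And>j. norm (c j) \<le> real (Suc j) powr - (1 / p)"
    and f: "f \<in> lp 1" and \<alpha>: "0 < \<alpha>"
  defines "E \<equiv> {n. norm (shift_sum d c f n) > \<alpha>}"
  shows "finite E \<and> real (card E) \<le> (2 * lp_norm 1 f / \<alpha>) powr p / (1 - 1 / p)"
proof -
  let ?L = "lp_norm 1 f" and ?B = "(2 * lp_norm 1 f / \<alpha>) powr p / (1 - 1 / p)"
  define R where "R = 2 * ?L / \<alpha>"
  define M where "M = nat \<lfloor>R powr p\<rfloor>"
  have R0: "0 \<le> R" using \<alpha> by (simp add: R_def lp_norm_nonneg)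
  have M_le: "real M \<le> R powr p" by (simp add: M_def)
  have tail: "norm (c j) \<le> 1 / R" if "M \<le> j" "0 < R" for j
  proof -
    \<comment> \<open>\<open>c j\<close> is the coefficient of index \<open>j + 1\<close>, so \<open>j \<ge> M\<close> means an index above \<open>R powr p\<close>\<close>
    have "R powr p \<le> real (Suc j)"
      using that unfolding M_def by linarith
    then have "(R powr p) powr (1 / p) \<le> real (Suc j) powr (1 / p)"
      using p by (intro powr_mono2) auto
    then have "R \<le> real (Suc j) powr (1 / p)"
      using p R0 by (simp add: powr_powr)
    then have "real (Suc j) powr - (1 / p) \<le> 1 / R"
      unfolding powr_minus using \<open>0 < R\<close>
      by (simp only: inverse_eq_divide frac_le order_refl zero_le_one)
    then show ?thesis using cp[of j] by linarith
  qed
  define A where "A n = (\<Sum>j<M. norm (f (n - d j)) * norm (c j))" for n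
  have big: "\<alpha> / 2 \<le> A n" if "n \<in> E" for n
  proof -
    have "?L \<noteq> 0"
    proof
      assume "?L = 0"
      then have "norm (f m) \<le> 0" for m
        using sum_comp_inj_le_lp_norm_1[OF f, of "{m}" id] by simp
      then have "shift_sum d c f n = 0" by (simp add: shift_sum_def)
      with that \<alpha> show False by (simp add: E_def)
    qed
    with \<alpha> have Rpos: "0 < R"
      using lp_norm_nonneg[of 1 f] by (simp add: R_def)
    let ?w = "\<lambda>j. norm (f (n - d j))"
    have "(\<lambda>j. (if j \<in> {..<M} then ?w j * norm (c j) else 0) + ?w j * (1 / R))
        sums (A n + suminf ?w * (1 / R))"
      unfolding A_def
      by (intro sums_add sums_If_finite_set sums_mult2 summable_sums summable_translates f) simp
    then have "(\<Sum>j. ?w j * norm (c j)) \<le> A n + suminf ?w * (1 / R)"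
    proof (rule sums_le[OF _ summable_sums[OF summable_shift_sum[OF f]], rotated])
      fix j
      show "?w j * norm (c j) \<le> (if j \<in> {..<M} then ?w j * norm (c j) else 0) + ?w j * (1 / R)"
        using tail[of j] Rpos mult_left_mono[of "norm (c j)" "1 / R" "?w j"] by auto
    qed
    also have "suminf ?w * (1 / R) \<le> ?L * (1 / R)"
      using Rpos by (intro mult_right_mono summable_translates f) auto
    also have "?L * (1 / R) = \<alpha> / 2"
      using \<open>?L \<noteq> 0\<close> \<alpha> by (simp add: R_def)
    finally have "(\<Sum>j. ?w j * norm (c j)) \<le> A n + \<alpha> / 2" by simp
    with that norm_shift_sum_le[OF f, of n] show ?thesis
      by (simp add: E_def)
  qed
  have fin: "real (card F) \<le> ?B" if F: "F \<subseteq> E" "finite F" for F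
  proof -
    have "real (card F) * (\<alpha> / 2) \<le> (\<Sum>n\<in>F. A n)"
      using sum_mono[of F "\<lambda>_. \<alpha> / 2" A] big F by auto
    also have "\<dots> = (\<Sum>j<M. (\<Sum>n\<in>F. norm (f (n - d j))) * norm (c j))"
      unfolding A_def by (subst sum.swap) (simp add: sum_distrib_right)
    also have "\<dots> \<le> (\<Sum>j<M. ?L * real (Suc j) powr - (1 / p))"
      by (intro sum_mono mult_mono sum_comp_inj_le_lp_norm_1 cp f F lp_norm_nonneg)
         (auto simp: inj_on_def)
    also have "\<dots> = ?L * (\<Sum>j<M. real (Suc j) powr - (1 / p))"
      by (simp add: sum_distrib_left)
    also have "\<dots> \<le> ?L * (real M powr (1 - 1 / p) / (1 - 1 / p))"
      using p by (intro mult_left_mono sum_powr_minus_le lp_norm_nonneg) auto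
    also have "\<dots> \<le> ?L * ((R powr p) powr (1 - 1 / p) / (1 - 1 / p))"
      using p M_le by (intro mult_left_mono divide_right_mono powr_mono2 lp_norm_nonneg) auto
    also have "(R powr p) powr (1 - 1 / p) = R powr (p - 1)"
      using p by (simp add: powr_powr algebra_simps)
    finally have "2 / \<alpha> * (real (card F) * (\<alpha> / 2))
        \<le> 2 / \<alpha> * (?L * (R powr (p - 1) / (1 - 1 / p)))"
      using \<alpha> by (intro mult_left_mono) auto
    then have "real (card F) \<le> R * R powr (p - 1) / (1 - 1 / p)"
      using \<alpha> by (simp add: R_def)
    also have "R * R powr (p - 1) = R powr p"
      using R0 by (cases "R = 0") (simp_all add: powr_diff)
    finally show ?thesis by (simp add: R_def)
  qed
  \<comment> \<open>a common bound on the finite subsets of \<open>E\<close> also shows that \<open>E\<close> is finite\<close>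
  have "finite E \<and> card E \<le> nat \<lfloor>?B\<rfloor>"
    by (rule finite_if_finite_subsets_card_bdd) (use fin in \<open>simp add: le_nat_floor\<close>)
  with fin[of E] show ?thesis by blast
qed

lemma shift_sum_weak_bound:
  assumes p: "1 < p" and cp: "\<And>j. norm (c j) \<le> real (Suc j) powr - (1 / p)" and f: "f \<in> lp 1"
  shows "shift_sum d c f \<in> weak_lp p"
    and "weak_lp_norm p (shift_sum d c f) \<le> 2 / (1 - 1 / p) powr (1 / p) * lp_norm 1 f"
proof -
  let ?L = "lp_norm 1 f"
  have bnd: "\<alpha> * real (card {n. norm (shift_sum d c f n) > \<alpha>}) powr (1 / p)
      \<le> 2 / (1 - 1 / p) powr (1 / p) * ?L" if \<alpha>: "0 < \<alpha>" for \<alpha>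
  proof -
    have "real (card {n. norm (shift_sum d c f n) > \<alpha>}) powr (1 / p)
        \<le> ((2 * ?L / \<alpha>) powr p / (1 - 1 / p)) powr (1 / p)"
      using shift_sum_superlevel_bound[OF p cp f \<alpha>] p by (intro powr_mono2) auto
    also have "\<dots> = (2 * ?L / \<alpha>) / (1 - 1 / p) powr (1 / p)"
      using p \<alpha> lp_norm_nonneg[of 1 f]
      by (subst powr_divide) (auto simp: powr_powr)
    finally have "\<alpha> * real (card {n. norm (shift_sum d c f n) > \<alpha>}) powr (1 / p)
        \<le> \<alpha> * ((2 * ?L / \<alpha>) / (1 - 1 / p) powr (1 / p))"
      using \<alpha> by (intro mult_left_mono) auto
    then show ?thesis using \<alpha> by simp
  qed
  show "shift_sum d c f \<in> weak_lp p"
    unfolding weak_lp_def mem_Collect_eq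
  proof (intro conjI allI impI)
    show "finite {n. norm (shift_sum d c f n) > \<alpha>}" if "0 < \<alpha>" for \<alpha>
      using shift_sum_superlevel_bound[OF p cp f that] by blast
    show "bdd_above ((\<lambda>\<alpha>. \<alpha> * real (card {n. norm (shift_sum d c f n) > \<alpha>}) powr (1 / p)) ` {0<..})"
      by (rule bdd_aboveI2[where M = "2 / (1 - 1 / p) powr (1 / p) * ?L"]) (use bnd in simp)
  qed
  show "weak_lp_norm p (shift_sum d c f) \<le> 2 / (1 - 1 / p) powr (1 / p) * ?L"
    unfolding weak_lp_norm_def by (rule cSUP_least) (use bnd in auto)
qed

section \<open>Testing on the unit mass at the origin\<close>

lemma shift_sum_unit_mass: "shift_sum d c (\<lambda>n. of_bool (n = 0)) (d j) = c j"
proof -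
  have "(\<lambda>i. c i * of_bool (d j - d i = 0)) = (\<lambda>i. if i \<in> {j} then c i else 0)"
    using injD[OF inj_d] by fastforce
  also have "\<dots> sums c j"
    using sums_If_finite_set[of "{j}" c] by simp
  finally show ?thesis by (simp add: shift_sum_def sums_iff)
qed

lemma shift_sum_unit_mass_lp:
  assumes "shift_sum d c (\<lambda>n. of_bool (n = 0)) \<in> lp p"
  shows "summable (\<lambda>j. norm (c j) powr p)"
proof -
  let ?g = "\<lambda>n. norm (shift_sum d c (\<lambda>n. of_bool (n = 0)) n) powr p"
  have "?g summable_on range d"
    using assms unfolding lp_def by (blast intro: summable_on_subset_banach)
  then have "(?g \<circ> d) summable_on UNIV"
    using inj_d by (simp add: summable_on_reindex)
  then show ?thesis
    by (simp add: o_def shift_sum_unit_mass summable_on_UNIV_nonneg_real_iff)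
qed

text \<open>
  If the first \<open>N\<close> coefficients exceed \<open>\<alpha>\<close>, the superlevel set at \<open>\<alpha>\<close> contains at least the \<open>N\<close>
  distinct points \<open>d 0, \<dots>, d (N - 1)\<close>.
\<close>

lemma shift_sum_unit_mass_weak_lp:
  assumes "shift_sum d c (\<lambda>n. of_bool (n = 0)) \<in> weak_lp p" "0 < p"
  shows "\<exists>B. \<forall>N \<alpha>. 0 < \<alpha> \<longrightarrow> (\<forall>j<N. \<alpha> < norm (c j)) \<longrightarrow> \<alpha> * real N powr (1 / p) \<le> B"
proof -
  let ?g = "shift_sum d c (\<lambda>n. of_bool (n = 0))"
  obtain B where B: "\<And>\<alpha>. 0 < \<alpha> \<Longrightarrow> \<alpha> * real (card {n. norm (?g n) > \<alpha>}) powr (1 / p) \<le> B"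
    using assms unfolding weak_lp_def bdd_above_def by auto
  have "\<alpha> * real N powr (1 / p) \<le> B" if \<alpha>: "0 < \<alpha>" "\<forall>j<N. \<alpha> < norm (c j)" for N \<alpha>
  proof -
    have "card (d ` {..<N}) \<le> card {n. norm (?g n) > \<alpha>}"
      using assms \<alpha> by (intro card_mono) (auto simp: weak_lp_def shift_sum_unit_mass)
    then have "N \<le> card {n. norm (?g n) > \<alpha>}"
      using inj_d by (simp add: card_image inj_on_subset)
    then have "\<alpha> * real N powr (1 / p) \<le> \<alpha> * real (card {n. norm (?g n) > \<alpha>}) powr (1 / p)"
      using assms(2) \<alpha> by (intro mult_left_mono powr_mono2) auto
    with B[OF \<alpha>(1)] show ?thesis by linarith
  qed
  then show ?thesis by blast
qed

end

lemma unit_mass_in_lp: "(\<lambda>n. of_bool (n = 0)) \<in> lp p"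
  unfolding lp_def mem_Collect_eq
proof (rule finite_nonzero_values_imp_summable_on)
  show "finite {n \<in> UNIV. norm (of_bool (n = (0 :: int)) :: complex) powr p \<noteq> 0}"
    by (rule finite_subset[of _ "{0 :: int}"]) auto
qed

lemma unit_mass_in_schwartz: "(\<lambda>n. of_bool (n = 0)) \<in> schwartz"
proof -
  have "\<bar>real_of_int n\<bar> ^ N * norm (of_bool (n = 0) :: complex) \<le> 1" for N :: nat and n
    by (cases "n = 0") (auto simp: power_0_left)
  then show ?thesis unfolding schwartz_def by blast
qed

text \<open>
  The extension \<open>T\<close> is prescribed only on the Schwartz space, so a test function for necessity
  must be taken from there.
\<close>

lemma extends_to_bounded_unit_mass:
  assumes "extends_to_bounded (lp 1) (lp_norm 1) Y normY t"
  shows "t (\<lambda>n. of_bool (n = 0)) \<in> Y"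
proof -
  obtain T where "\<forall>f\<in>schwartz. T f = t f" "\<forall>f\<in>lp 1. T f \<in> Y"
    using assms unfolding extends_to_bounded_def by blast
  then show ?thesis using unit_mass_in_schwartz unit_mass_in_lp[of 1] by metis
qed

section \<open>The fractional integral along powers\<close>

lemma frac_int_eq_shift_sum:
  "frac_int k s = shift_sum (\<lambda>j. int (Suc j) ^ k) (\<lambda>j. 1 / of_nat (Suc j) powr s)"
  by (intro ext) (simp add: frac_int_def shift_sum_def)

lemma norm_frac_int_coeff:
  "norm (1 / of_nat (Suc j) powr s :: complex) = real (Suc j) powr - Re s"
proof -
  have "norm (of_nat (Suc j) powr s :: complex) = Re (of_nat (Suc j)) powr Re s"
    by (rule norm_powr_real_powr) auto
  then have "norm (of_nat (Suc j) powr s :: complex) = real (Suc j) powr Re s"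
    by (simp only: complex_Re_of_nat)
  then show ?thesis
    by (simp only: norm_divide norm_one powr_minus inverse_eq_divide)
qed

theorem theorem1:
  fixes p lam gam :: real and k :: nat
  assumes "1 < p" and "k \<ge> 1" and "0 < lam" and "lam < 1"
  shows "(weak_type_1 p (frac_int k (Complex lam gam)) \<longleftrightarrow> lam \<ge> 1 / p) \<and>
         (bounded_lp_lq 1 p (frac_int k (Complex lam gam)) \<longleftrightarrow> lam > 1 / p)"
proof -
  define d where "d = (\<lambda>j. int (Suc j) ^ k)"
  define c where "c = (\<lambda>j. 1 / of_nat (Suc j) powr Complex lam gam :: complex)"
  have T: "frac_int k (Complex lam gam) = shift_sum d c"
    by (simp only: frac_int_eq_shift_sum d_def c_def)
  have norm_c: "norm (c j) = real (Suc j) powr - lam" for j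
    by (simp only: c_def norm_frac_int_coeff complex.sel)
  have d: "inj d"
    using assms(2) unfolding d_def by (auto intro!: injI dest: power_eq_imp_eq_base)
  have c1: "norm (c j) \<le> 1" for j
    using assms(3) powr_mono[of "- lam" 0 "real (Suc j)"] by (simp add: norm_c)
  have "summable (\<lambda>j. norm (c j) powr p) \<longleftrightarrow> summable (\<lambda>j. real (Suc j) powr (- lam * p))"
    by (simp only: norm_c powr_powr)
  also have "\<dots> \<longleftrightarrow> - lam * p < - 1"
    by (simp only: summable_Suc_iff[where f = "\<lambda>j. real j powr _"] summable_real_powr_iff)
  also have "\<dots> \<longleftrightarrow> lam > 1 / p"
    using assms(1) by (simp add: field_simps)
  finally have summable_c: "summable (\<lambda>j. norm (c j) powr p) \<longleftrightarrow> lam > 1 / p" .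

  have "weak_type_1 p (shift_sum d c)" if "lam \<ge> 1 / p"
  proof -
    have "norm (c j) \<le> real (Suc j) powr - (1 / p)" for j
      unfolding norm_c using that by (intro powr_mono) auto
    then show ?thesis
      unfolding weak_type_1_def
      using shift_sum_weak_bound[of d c p, OF d c1 assms(1)]
      by (intro shift_sum_extends_to_bounded[of d c, OF d c1]) blast
  qed
  moreover have "lam \<ge> 1 / p" if "weak_type_1 p (shift_sum d c)"
  proof (rule ccontr)
    assume "\<not> lam \<ge> 1 / p"
    then have e: "0 < 1 / p - lam" by simp
    have "shift_sum d c (\<lambda>n. of_bool (n = 0)) \<in> weak_lp p"
      using that unfolding weak_type_1_def by (rule extends_to_bounded_unit_mass)
    then obtain B where B: "\<And>N \<alpha>. 0 < \<alpha> \<Longrightarrow> (\<forall>j<N. \<alpha> < norm (c j)) \<Longrightarrow>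
        \<alpha> * real N powr (1 / p) \<le> B"
      using shift_sum_unit_mass_weak_lp[of d c p, OF d c1] assms(1) by auto
    \<comment> \<open>test at the level \<open>N powr - lam / 2\<close>; the factor \<open>1 / 2\<close> makes the comparison strict\<close>
    have le: "real N powr (1 / p - lam) \<le> 2 * B" if N: "0 < N" for N
    proof -
      have "real N powr - lam / 2 < norm (c j)" if "j < N" for j
      proof -
        have "real N powr - lam \<le> real (Suc j) powr - lam"
          using that assms(3) by (intro powr_mono2') auto
        moreover have "0 < real N powr - lam" using N by simp
        ultimately show ?thesis unfolding norm_c by linarith
      qed
      then have "real N powr - lam / 2 * real N powr (1 / p) \<le> B"
        using N by (intro B) auto
      moreover have "real N powr - lam * real N powr (1 / p) = real N powr (1 / p - lam)"
        by (simp add: powr_add[symmetric])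
      ultimately show ?thesis by simp
    qed
    \<comment> \<open>an \<open>N\<close> beyond the point where the left-hand side reaches \<open>2 * B\<close>\<close>
    obtain N :: nat where N: "\<bar>2 * B\<bar> powr (1 / (1 / p - lam)) < real N"
      using reals_Archimedean2 by blast
    then have "0 < N" by (metis of_nat_0_less_iff order_le_less_trans powr_ge_zero)
    have "(\<bar>2 * B\<bar> powr (1 / (1 / p - lam))) powr (1 / p - lam) < real N powr (1 / p - lam)"
      using N e by (intro powr_less_mono2) auto
    moreover have "(\<bar>2 * B\<bar> powr (1 / (1 / p - lam))) powr (1 / p - lam) = \<bar>2 * B\<bar>"
      using e by (simp only: powr_powr) simp
    ultimately show False using le[OF \<open>0 < N\<close>] by linarith
  qed
  moreover have "bounded_lp_lq 1 p (shift_sum d c)" if "lam > 1 / p"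
    unfolding bounded_lp_lq_def
    using shift_sum_strong_bound[of d c p, OF d c1 assms(1)] summable_c that
    by (intro shift_sum_extends_to_bounded[of d c, OF d c1]) blast
  moreover have "lam > 1 / p" if "bounded_lp_lq 1 p (shift_sum d c)"
    using extends_to_bounded_unit_mass[of "lp p" "lp_norm p" "shift_sum d c"]
      shift_sum_unit_mass_lp[of d c p, OF d c1] summable_c that
    unfolding bounded_lp_lq_def by blast
  ultimately show ?thesis unfolding T by blast
qed

end
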